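(* Let $A,B\in\mathbb{R}^{n\times n}$. The $\top$-Stein matrix equation $X=AX^\top B+C$ in the unknown $X\in\mathbb{R}^{n\times n}$ is uniquely solvable (i.e. has exactly one solution for each $C\in\mathbb{R}^{n\times n}$) if and only if both of the following conditions are satisfied: (a) the set $\sigma(A^\top B)\setminus\{-1\}$ is $\top$-reciprocal free; (b) $-1$ may be an eigenvalue of $A^\top B$, but if it is, it must be simple.
   Context: $\sigma(M)$ denotes the set of (complex) eigenvalues of a square matrix $M$; an eigenvalue is simple if its algebraic multiplicity is one. A set $\Lambda=\{\lambda_1,\dots,\lambda_k\}$ of complex numbers is called $\top$-reciprocal free if $\lambda_i\neq 1/\lambda_j$ for all indices $i,j$ (the case $i=j$ included), where $0$ and $\infty$ are regarded as reciprocals of each other; so for finite numbers the condition is $\lambda_i\lambda_j\neq 1$ for all $i,j$. *)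

theory Defs
  imports "Jordan_Normal_Form.Spectral_Radius"
begin

(* The eigenvalues of a real matrix are taken over the complex numbers. *)
definition complex_spectrum :: "real mat \<Rightarrow> complex set" where
  "complex_spectrum M = spectrum (map_mat complex_of_real M)"

definition algebraic_multiplicity :: "real mat \<Rightarrow> complex \<Rightarrow> nat" where
  "algebraic_multiplicity M z = order z (char_poly (map_mat complex_of_real M))"

definition simple_eigenvalue :: "real mat \<Rightarrow> complex \<Rightarrow> bool" where
  "simple_eigenvalue M z \<longleftrightarrow> z \<in> complex_spectrum M \<and> algebraic_multiplicity M z = 1"

(* Written multiplicatively: x \<noteq> 1 / y would be wrong at 0, since 1 / 0 = 0 in HOL
   whereas the reciprocal of 0 is meant to be infinity.  The case x = y is included. *)
definition top_reciprocal_free :: "complex set \<Rightarrow> bool" where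
  "top_reciprocal_free L \<longleftrightarrow> (\<forall>x\<in>L. \<forall>y\<in>L. x * y \<noteq> 1)"

definition top_stein_uniquely_solvable :: "nat \<Rightarrow> real mat \<Rightarrow> real mat \<Rightarrow> bool" where
  "top_stein_uniquely_solvable n A B \<longleftrightarrow>
     (\<forall>C \<in> carrier_mat n n. \<exists>!X. X \<in> carrier_mat n n \<and> X = A * transpose_mat X * B + C)"

end

theory Submission
  imports Defs
begin

text \<open>
  Put \<open>M = A\<^sup>T B\<close>.  If \<open>X = A X\<^sup>T B\<close>, then \<open>Y = X\<^sup>T B\<close> satisfies \<open>X = A Y\<close>, hence
  \<open>Y = Y\<^sup>T M\<close>; conversely, if \<open>Y = Y\<^sup>T M\<close>, then \<open>X = A Y\<close> satisfies \<open>X\<^sup>T B = Y\<close>, hence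
  \<open>X = A X\<^sup>T B\<close>.  The two maps are inverse to each other, so the question depends on the single
  matrix \<open>M\<close>, with no reduction of the pair \<open>A, B\<close> to a simultaneous normal form.  The same
  substitution handles the inhomogeneous equations, and on \<open>n \<times> n\<close> matrices an injective
  linear map is surjective, so unique solvability means that \<open>Y = Y\<^sup>T M\<close> has only the zero
  solution (\<open>uniquely_solvable_iff_only_zero_cosquare\<close>).

  In the equation \<open>Y = Y\<^sup>T M\<close> the unknown is the Gram matrix of a bilinear form.  A change of
  basis acts on it by congruence and on \<open>M\<close> by similarity
  (\<open>only_zero_cosquare_similar\<close>); over the complex numbers \<open>M\<close> can therefore be taken
  triangular, with diagonal \<open>t\<^sub>1, \<dots>, t\<^sub>n\<close> in any chosen order.  For upper triangular \<open>M\<close> the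
  entries at \<open>(i,j)\<close> and \<open>(j,i)\<close> satisfy, modulo entries with smaller index sum, a
  two by two system with determinant \<open>1 - t\<^sub>i t\<^sub>j\<close>, and a diagonal entry is multiplied by
  \<open>1 - t\<^sub>i\<close>.  So the only solution is zero if no \<open>t\<^sub>i\<close> is 1 and no two entries at different
  positions have product 1 (\<open>only_zero_cosquare_upper_triangular\<close>).  If this fails, bring the
  offending eigenvalues to the front of a Schur form of \<open>M\<^sup>T\<close> and write down a nonzero solution
  supported in the upper left corner (\<open>not_only_zero_cosquare_corner_one\<close>,
  \<open>not_only_zero_cosquare_corner_pair\<close>).

  What remains is to compare this with the two conditions on the spectrum.  An eigenvalue is its
  own reciprocal only if it is 1 or \<open>-1\<close>.  The value 1 is always forbidden, whereas \<open>-1\<close> is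
  harmless at one position and fatal at two.
\<close>

section \<open>The homogeneous equation in one matrix\<close>

text \<open>
  An invertible solution \<open>Y\<close> has cosquare \<open>(Y\<^sup>T)\<^sup>-\<^sup>1 Y = M\<close>, which explains the name.
\<close>
definition only_zero_cosquare :: "nat \<Rightarrow> 'a::comm_ring_1 mat \<Rightarrow> bool" where
  "only_zero_cosquare n M \<longleftrightarrow> (\<forall>Y \<in> carrier_mat n n. Y = transpose_mat Y * M \<longrightarrow> Y = 0\<^sub>m n n)"

lemma mult_transpose_entry:
  fixes Y :: "'a::comm_ring_1 mat"
  assumes "Y \<in> carrier_mat n n" "M \<in> carrier_mat n n" "i < n" "j < n"
  shows "(transpose_mat Y * M) $$ (i,j) = (\<Sum>k<n. Y $$ (k,i) * M $$ (k,j))"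
  using assms by (simp add: scalar_prod_def lessThan_atLeast0)

text \<open>
  Entrywise forms of the equation.  They are kept as rules with an introduction and a destruction
  direction because the entrywise equation, used as a rewrite rule, produces further instances
  of its own left-hand side.
\<close>
lemma eq_transpose_mult_addI:
  fixes Y :: "'a::comm_ring_1 mat"
  assumes "Y \<in> carrier_mat n n" "M \<in> carrier_mat n n" "D \<in> carrier_mat n n"
    and entries: "\<And>i j. i < n \<Longrightarrow> j < n \<Longrightarrow>
      Y $$ (i,j) = (\<Sum>k<n. Y $$ (k,i) * M $$ (k,j)) + D $$ (i,j)"
  shows "Y = transpose_mat Y * M + D"
proof (rule eq_matI)
  fix i j assume "i < dim_row (transpose_mat Y * M + D)" "j < dim_col (transpose_mat Y * M + D)"
  then have ij: "i < n" "j < n" using assms(3) by auto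
  then have "(transpose_mat Y * M + D) $$ (i,j) = (transpose_mat Y * M) $$ (i,j) + D $$ (i,j)"
    using assms(1-3) by simp
  then show "Y $$ (i,j) = (transpose_mat Y * M + D) $$ (i,j)"
    unfolding mult_transpose_entry[OF assms(1,2) ij] entries[OF ij, symmetric] by (rule sym)
qed (use assms(1-3) in auto)

lemma eq_transpose_multI:
  fixes Y :: "'a::comm_ring_1 mat"
  assumes "Y \<in> carrier_mat n n" "M \<in> carrier_mat n n"
    and entries: "\<And>i j. i < n \<Longrightarrow> j < n \<Longrightarrow> Y $$ (i,j) = (\<Sum>k<n. Y $$ (k,i) * M $$ (k,j))"
  shows "Y = transpose_mat Y * M"
proof (rule eq_matI)
  fix i j assume "i < dim_row (transpose_mat Y * M)" "j < dim_col (transpose_mat Y * M)"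
  then have ij: "i < n" "j < n" using assms(1,2) by auto
  show "Y $$ (i,j) = (transpose_mat Y * M) $$ (i,j)"
    unfolding mult_transpose_entry[OF assms(1,2) ij] by (rule entries[OF ij])
qed (use assms(1,2) in auto)

lemma eq_transpose_multD:
  fixes Y :: "'a::comm_ring_1 mat"
  assumes "Y \<in> carrier_mat n n" "M \<in> carrier_mat n n" "Y = transpose_mat Y * M" "i < n" "j < n"
  shows "Y $$ (i,j) = (\<Sum>k<n. Y $$ (k,i) * M $$ (k,j))"
  using arg_cong[OF assms(3), of "\<lambda>m. m $$ (i,j)"] mult_transpose_entry[OF assms(1,2,4,5)]
  by (rule trans)

section \<open>From injectivity to unique solvability\<close>

lemma sum_lessThan_mult_div_mod:
  fixes g :: "nat \<Rightarrow> nat \<Rightarrow> 'a::comm_monoid_add"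
  shows "(\<Sum>l<n * n. g (l div n) (l mod n)) = (\<Sum>a<n. \<Sum>b<n. g a b)"
proof -
  have "(\<Sum>a<n. \<Sum>b<n. g a b) = (\<Sum>a<n. \<Sum>l\<in>{a*n..<a*n+n}. g (l div n) (l mod n))"
  proof (rule sum.cong[OF refl])
    fix a assume "a \<in> {..<n}"
    have "(\<Sum>l\<in>{a*n..<a*n+n}. g (l div n) (l mod n)) =
      (\<Sum>b\<in>{0..<n}. g ((b + a*n) div n) ((b + a*n) mod n))"
      using sum.shift_bounds_nat_ivl[of "\<lambda>l. g (l div n) (l mod n)" 0 "a*n" n] by (simp add: add.commute)
    also have "\<dots> = (\<Sum>b<n. g a b)" by (rule sum.cong) auto
    finally show "(\<Sum>b<n. g a b) = (\<Sum>l\<in>{a*n..<a*n+n}. g (l div n) (l mod n))" by simp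
  qed
  also have "\<dots> = (\<Sum>l<n * n. g (l div n) (l mod n))" by (rule sum.nat_group)
  finally show ?thesis by simp
qed

text \<open>
  Square matrices of size \<open>n\<close> form a space of finite dimension \<open>n\<^sup>2\<close>, so the linear map taking
  \<open>Y\<close> to \<open>Y - Y\<^sup>T M\<close> is onto once its kernel is zero.  The proof lists the entries of a matrix row
  by row as a vector, so that the map becomes a square matrix with nonzero determinant.
\<close>
lemma inhomogeneous_solvable:
  fixes M :: "'a::field mat"
  assumes M: "M \<in> carrier_mat n n" and D: "D \<in> carrier_mat n n" and triv: "only_zero_cosquare n M"
  shows "\<exists>Y \<in> carrier_mat n n. Y = transpose_mat Y * M + D"
proof -
  define N where "N = n * n"
  \<comment> \<open>Position \<open>(i,j)\<close> is stored at index \<open>i * n + j\<close>; the second summand of \<open>K\<close> sends the unit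
     matrix at \<open>(a,i)\<close> to row \<open>i\<close>, filled with row \<open>a\<close> of \<open>M\<close>.\<close>
  define K where "K = mat N N (\<lambda>(p,l). (if l = p then 1 else 0)
     - (if l mod n = p div n then M $$ (l div n, p mod n) else 0))"
  define unvec where "unvec v = mat n n (\<lambda>(i,j). v $ (i * n + j))" for v :: "'a vec"
  have K: "K \<in> carrier_mat N N" by (simp add: K_def)
  have idx: "i * n + j < N" if "i < n" "j < n" for i j
  proof -
    have "i * n + j < (i + 1) * n" using that by simp
    also have "\<dots> \<le> N" unfolding N_def using that by (intro mult_right_mono) auto
    finally show ?thesis .
  qed
  have split: "p div n < n \<and> p mod n < n" if "p < N" for p
    using that unfolding N_def by (metis less_mult_imp_div_less mod_less_divisor mult_0_right not_gr_zero not_less_zero)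
  have Kv: "(K *\<^sub>v v) $ (i * n + j) = unvec v $$ (i,j) - (\<Sum>k<n. unvec v $$ (k,i) * M $$ (k,j))"
    if v: "v \<in> carrier_vec N" and ij: "i < n" "j < n" for v i j
  proof -
    have "(K *\<^sub>v v) $ (i * n + j) = (\<Sum>l<N. K $$ (i*n+j,l) * v $ l)"
      using idx[OF ij] v K by (simp add: scalar_prod_def lessThan_atLeast0)
    also have "\<dots> = (\<Sum>l<N. (if l = i*n+j then v $ l else 0)
        - (if l mod n = i then v $ (l div n * n + l mod n) * M $$ (l div n, j) else 0))"
      by (rule sum.cong) (use ij idx[OF ij] in \<open>auto simp: K_def algebra_simps\<close>)
    also have "\<dots> = v $ (i*n+j) - (\<Sum>l<N. (if l mod n = i then v $ (l div n * n + l mod n) * M $$ (l div n, j) else 0))"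
      using idx[OF ij] by (simp add: sum_subtractf)
    also have "(\<Sum>l<N. (if l mod n = i then v $ (l div n * n + l mod n) * M $$ (l div n, j) else 0))
      = (\<Sum>a<n. \<Sum>b<n. if b = i then v $ (a * n + b) * M $$ (a,j) else 0)"
      unfolding N_def by (rule sum_lessThan_mult_div_mod)
    also have "\<dots> = (\<Sum>a<n. unvec v $$ (a,i) * M $$ (a,j))"
      by (rule sum.cong) (use ij in \<open>auto simp: unvec_def\<close>)
    finally show ?thesis using ij by (simp add: unvec_def)
  qed
  have "det K \<noteq> 0"
  proof
    assume "det K = 0"
    then obtain v where v: "v \<in> carrier_vec N" "v \<noteq> 0\<^sub>v N" "K *\<^sub>v v = 0\<^sub>v N"
      using det_0_iff_vec_prod_zero_field[OF K] by blast
    have uv: "unvec v \<in> carrier_mat n n" by (simp add: unvec_def)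
    have "unvec v $$ (i,j) = (\<Sum>k<n. unvec v $$ (k,i) * M $$ (k,j))" if "i < n" "j < n" for i j
      using Kv[OF v(1) that] idx[OF that] unfolding v(3) by simp
    then have "unvec v = transpose_mat (unvec v) * M"
      by (rule eq_transpose_multI[OF uv M])
    then have z: "unvec v = 0\<^sub>m n n"
      using triv uv unfolding only_zero_cosquare_def by blast
    have "v $ p = 0" if "p < N" for p
    proof -
      have "v $ p = unvec v $$ (p div n, p mod n)" using split[OF that] by (simp add: unvec_def)
      then show ?thesis using z split[OF that] by simp
    qed
    then have "v = 0\<^sub>v N" using v(1) by (intro eq_vecI) auto
    then show False using v(2) by simp
  qed
  from det_non_zero_imp_unit[OF K this, unfolded Units_def ring_mat_def]
  obtain L where L: "L \<in> carrier_mat N N" "K * L = 1\<^sub>m N" by auto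
  define d where "d = vec N (\<lambda>p. D $$ (p div n, p mod n))"
  define v where "v = L *\<^sub>v d"
  have d: "d \<in> carrier_vec N" by (simp add: d_def)
  then have v: "v \<in> carrier_vec N" using L by (simp add: v_def)
  have "K *\<^sub>v v = d" unfolding v_def using assoc_mult_mat_vec[OF K L(1) d] L(2) d by simp
  then have "unvec v $$ (i,j) = (\<Sum>k<n. unvec v $$ (k,i) * M $$ (k,j)) + D $$ (i,j)"
    if "i < n" "j < n" for i j
    using Kv[OF v that] idx[OF that] that by (simp add: d_def algebra_simps)
  then have "unvec v = transpose_mat (unvec v) * M + D"
    by (intro eq_transpose_mult_addI[OF _ M D]) (simp add: unvec_def)
  moreover have "unvec v \<in> carrier_mat n n" by (simp add: unvec_def)
  ultimately show ?thesis by blast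
qed

text \<open>
  The substitution \<open>Y = X\<^sup>T B\<close> turns \<open>X = A X\<^sup>T B + C\<close> into \<open>X = A Y + C\<close> together with
  \<open>Y = Y\<^sup>T (A\<^sup>T B) + C\<^sup>T B\<close>, so each solution of the latter equation yields a solution \<open>X\<close>, and the
  difference of two solutions \<open>X\<close> yields a solution of the homogeneous equation in \<open>Y\<close>.
\<close>
lemma uniquely_solvable_iff_only_zero_cosquare:
  assumes A: "A \<in> carrier_mat n n" and B: "B \<in> carrier_mat n n"
  shows "top_stein_uniquely_solvable n A B \<longleftrightarrow> only_zero_cosquare n (transpose_mat A * B)"
proof
  assume uniq: "top_stein_uniquely_solvable n A B"
  show "only_zero_cosquare n (transpose_mat A * B)"
    unfolding only_zero_cosquare_def
  proof (intro ballI impI)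
    fix Y :: "real mat" assume Y: "Y \<in> carrier_mat n n" and eq: "Y = transpose_mat Y * (transpose_mat A * B)"
    have "transpose_mat (A * Y) * B = Y"
      using eq A B Y by (simp add: transpose_mult[OF A Y] assoc_mult_mat[of _ n n _ n _ n])
    then have "A * Y = A * transpose_mat (A * Y) * B + 0\<^sub>m n n"
      using A B Y by (simp add: assoc_mult_mat[of _ n n _ n _ n])
    moreover have "0\<^sub>m n n = A * transpose_mat (0\<^sub>m n n) * B + 0\<^sub>m n n" using A B by simp
    ultimately have "A * Y = 0\<^sub>m n n"
      using uniq A Y unfolding top_stein_uniquely_solvable_def
      by (metis mult_carrier_mat zero_carrier_mat)
    with \<open>transpose_mat (A * Y) * B = Y\<close> show "Y = 0\<^sub>m n n" using B by simp
  qed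
next
  assume triv: "only_zero_cosquare n (transpose_mat A * B)"
  have M: "transpose_mat A * B \<in> carrier_mat n n" using A B by simp
  show "top_stein_uniquely_solvable n A B"
    unfolding top_stein_uniquely_solvable_def
  proof (intro ballI ex_ex1I)
    fix C :: "real mat" assume C: "C \<in> carrier_mat n n"
    then have "transpose_mat C * B \<in> carrier_mat n n" using B by simp
    from inhomogeneous_solvable[OF M this triv] obtain Y where Y: "Y \<in> carrier_mat n n"
      and eq: "Y = transpose_mat Y * (transpose_mat A * B) + transpose_mat C * B" by blast
    have "transpose_mat (A * Y + C) * B = Y"
      using eq A B C Y by (simp add: transpose_add[of _ n n] transpose_mult[OF A Y]
        add_mult_distrib_mat[of _ n n _ _ n] assoc_mult_mat[of _ n n _ n _ n])
    then have "A * Y + C = A * transpose_mat (A * Y + C) * B + C"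
      using A B C Y by (simp add: assoc_mult_mat[of _ n n _ n _ n])
    then show "\<exists>X. X \<in> carrier_mat n n \<and> X = A * transpose_mat X * B + C"
      using A C Y by (intro exI[of _ "A * Y + C"]) auto
  next
    fix C X X' :: "real mat"
    assume C: "C \<in> carrier_mat n n"
      and "X \<in> carrier_mat n n \<and> X = A * transpose_mat X * B + C"
      and "X' \<in> carrier_mat n n \<and> X' = A * transpose_mat X' * B + C"
    then have X: "X \<in> carrier_mat n n" "X = A * transpose_mat X * B + C"
      and X': "X' \<in> carrier_mat n n" "X' = A * transpose_mat X' * B + C" by auto
    define Z where "Z = X - X'"
    define Y where "Y = transpose_mat Z * B"
    have Z: "Z \<in> carrier_mat n n" unfolding Z_def using X'(1) by (rule minus_carrier_mat)
    have "Z = (A * transpose_mat X * B + C) - (A * transpose_mat X' * B + C)"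
      unfolding Z_def using X(2) X'(2) by simp
    also have "\<dots> = A * transpose_mat X * B - A * transpose_mat X' * B"
      using A B C X(1) X'(1) by (intro eq_matI) auto
    also have "\<dots> = A * transpose_mat Z * B"
      using A B X(1) X'(1) unfolding Z_def
      by (simp add: transpose_minus[of _ n n] minus_mult_distrib_mat[of _ n n _ _ n]
        mult_minus_distrib_mat[of _ n n _ n])
    finally have ZA: "Z = A * Y" unfolding Y_def using A B Z by (simp add: assoc_mult_mat[of _ n n _ n _ n])
    have Y: "Y \<in> carrier_mat n n" unfolding Y_def using Z B by simp
    have "Y = transpose_mat (A * Y) * B" using ZA by (simp add: Y_def)
    then have "Y = transpose_mat Y * (transpose_mat A * B)"
      using A B Y by (simp add: transpose_mult[OF A Y] assoc_mult_mat[of _ n n _ n _ n])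
    then have "Y = 0\<^sub>m n n" using triv Y unfolding only_zero_cosquare_def by blast
    then have "Z = 0\<^sub>m n n" using ZA A by simp
    then show "X = X'" using X(1) X'(1) unfolding Z_def
      by (intro eq_matI) (auto, metis (no_types, lifting) carrier_matD(1) carrier_matD(2) eq_iff_diff_eq_0 index_minus_mat(1) index_zero_mat(1))
  qed
qed

section \<open>Extension of scalars and change of basis\<close>

text \<open>
  The equation is linear with real coefficients, so real and imaginary part of a complex solution
  are real solutions.
\<close>
lemma only_zero_cosquare_of_real:
  fixes M :: "real mat"
  assumes M: "M \<in> carrier_mat n n"
  shows "only_zero_cosquare n M \<longleftrightarrow> only_zero_cosquare n (map_mat complex_of_real M)"
proof
  assume triv: "only_zero_cosquare n M"
  show "only_zero_cosquare n (map_mat complex_of_real M)"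
    unfolding only_zero_cosquare_def
  proof (intro ballI impI)
    fix Y :: "complex mat" assume Y: "Y \<in> carrier_mat n n"
      and eq: "Y = transpose_mat Y * map_mat complex_of_real M"
    have ent: "Y $$ (i,j) = (\<Sum>k<n. Y $$ (k,i) * of_real (M $$ (k,j)))" if "i < n" "j < n" for i j
      using eq_transpose_multD[OF Y _ eq that] M that by simp
    have "map_mat Re Y = 0\<^sub>m n n"
    proof -
      have "map_mat Re Y $$ (i,j) = (\<Sum>k<n. map_mat Re Y $$ (k,i) * M $$ (k,j))" if "i < n" "j < n" for i j
        using arg_cong[OF ent[OF that], of Re] Y that by simp
      moreover have "map_mat Re Y \<in> carrier_mat n n" using Y by simp
      ultimately have "map_mat Re Y = transpose_mat (map_mat Re Y) * M"
        using M by (intro eq_transpose_multI)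
      then show ?thesis using triv Y unfolding only_zero_cosquare_def by (meson map_carrier_mat)
    qed
    moreover have "map_mat Im Y = 0\<^sub>m n n"
    proof -
      have "map_mat Im Y $$ (i,j) = (\<Sum>k<n. map_mat Im Y $$ (k,i) * M $$ (k,j))" if "i < n" "j < n" for i j
        using arg_cong[OF ent[OF that], of Im] Y that by simp
      moreover have "map_mat Im Y \<in> carrier_mat n n" using Y by simp
      ultimately have "map_mat Im Y = transpose_mat (map_mat Im Y) * M"
        using M by (intro eq_transpose_multI)
      then show ?thesis using triv Y unfolding only_zero_cosquare_def by (meson map_carrier_mat)
    qed
    ultimately show "Y = 0\<^sub>m n n"
    proof (intro eq_matI)
      fix i j assume "i < dim_row (0\<^sub>m n n :: complex mat)" "j < dim_col (0\<^sub>m n n :: complex mat)"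
      moreover assume "map_mat Re Y = 0\<^sub>m n n" "map_mat Im Y = 0\<^sub>m n n"
      then have "map_mat Re Y $$ (i,j) = 0\<^sub>m n n $$ (i,j)" "map_mat Im Y $$ (i,j) = 0\<^sub>m n n $$ (i,j)"
        by simp_all
      ultimately show "Y $$ (i,j) = 0\<^sub>m n n $$ (i,j)" using Y by (simp add: complex_eq_iff)
    qed (use Y in auto)
  qed
next
  assume triv: "only_zero_cosquare n (map_mat complex_of_real M)"
  show "only_zero_cosquare n M"
    unfolding only_zero_cosquare_def
  proof (intro ballI impI)
    fix Y :: "real mat" assume Y: "Y \<in> carrier_mat n n" and eq: "Y = transpose_mat Y * M"
    let ?Y = "map_mat complex_of_real Y"
    have ent: "Y $$ (i,j) = (\<Sum>k<n. Y $$ (k,i) * M $$ (k,j))" if "i < n" "j < n" for i j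
      by (rule eq_transpose_multD[OF Y M eq that])
    have "?Y $$ (i,j) = (\<Sum>k<n. ?Y $$ (k,i) * map_mat complex_of_real M $$ (k,j))" if "i < n" "j < n" for i j
      using arg_cong[OF ent[OF that], of complex_of_real] Y M that by simp
    moreover have "?Y \<in> carrier_mat n n" "map_mat complex_of_real M \<in> carrier_mat n n"
      using Y M by simp_all
    ultimately have "?Y = transpose_mat ?Y * map_mat complex_of_real M"
      by (intro eq_transpose_multI)
    then have z: "?Y = 0\<^sub>m n n" using triv Y unfolding only_zero_cosquare_def by (meson map_carrier_mat)
    show "Y = 0\<^sub>m n n"
    proof (rule eq_matI)
      fix i j assume "i < dim_row (0\<^sub>m n n :: real mat)" "j < dim_col (0\<^sub>m n n :: real mat)"
      then show "Y $$ (i,j) = 0\<^sub>m n n $$ (i,j)"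
        using Y arg_cong[OF z, of "\<lambda>m. m $$ (i,j)"] by simp
    qed (use Y in auto)
  qed
qed

text \<open>
  If \<open>M = P N Q\<close> with \<open>Q = P\<^sup>-\<^sup>1\<close>, then \<open>Z = Z\<^sup>T N\<close> implies that \<open>Y = Q\<^sup>T Z Q\<close> solves
  \<open>Y = Y\<^sup>T M\<close>, because the inner factors \<open>Q P\<close> cancel.
\<close>
lemma only_zero_cosquare_similar:
  fixes M N :: "'a::comm_ring_1 mat"
  assumes M: "M \<in> carrier_mat n n" and sim: "similar_mat M N" and triv: "only_zero_cosquare n M"
  shows "only_zero_cosquare n N"
proof -
  from sim obtain P Q where "similar_mat_wit M N P Q" unfolding similar_mat_def by blast
  note w = similar_mat_witD2[OF M this]
  show ?thesis unfolding only_zero_cosquare_def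
  proof (intro ballI impI)
    fix Z assume Z: "Z \<in> carrier_mat n n" and eq: "Z = transpose_mat Z * N"
    note assoc = assoc_mult_mat[of _ n n _ n _ n]
    have cancel: "R * (S * X) = X"
      if "R * S = 1\<^sub>m n" "R \<in> carrier_mat n n" "S \<in> carrier_mat n n" "X \<in> carrier_mat n n" for R S X :: "'a mat"
      using assoc[of R S X] that by simp
    have PQt: "transpose_mat P * transpose_mat Q = 1\<^sub>m n"
      using w(2) transpose_mult[OF w(7) w(6)] by simp
    define Y where "Y = transpose_mat Q * (Z * Q)"
    have Y: "Y \<in> carrier_mat n n" using w(7) Z by (simp add: Y_def)
    have Yt: "transpose_mat Y = transpose_mat Q * (transpose_mat Z * Q)"
      unfolding Y_def using w(7) Z by (simp add: transpose_mult[of _ n n _ n] assoc)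
    have "transpose_mat Y * M = transpose_mat Q * (transpose_mat Z * (Q * (P * (N * Q))))"
      unfolding Yt w(3) using w(5-7) Z by (simp add: assoc)
    also have "\<dots> = transpose_mat Q * (transpose_mat Z * (N * Q))"
      using cancel[OF w(2) w(7) w(6), of "N * Q"] w(5,7) by simp
    also have "\<dots> = transpose_mat Q * (transpose_mat Z * N * Q)" using w(5,7) Z by (simp add: assoc)
    also have "\<dots> = Y" unfolding Y_def eq[symmetric] ..
    finally have "Y = 0\<^sub>m n n" using triv Y unfolding only_zero_cosquare_def by metis
    moreover have "Z = transpose_mat P * (Y * P)"
      unfolding Y_def using w(6,7) Z
      by (simp add: assoc cancel[OF PQt] w(2))
    ultimately show "Z = 0\<^sub>m n n" using w by simp
  qed
qed

section \<open>Triangular matrices\<close>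

text \<open>
  Induction on \<open>i + j\<close>.  In the equation for entry \<open>(i,j)\<close>, the terms with \<open>k > j\<close> vanish since
  \<open>T\<close> is upper triangular, and those with \<open>k < j\<close> by induction, since they contain the entry
  \<open>(k,i)\<close>.  There remains \<open>Z\<^sub>i\<^sub>j = Z\<^sub>j\<^sub>i t\<^sub>j\<close>; the same equation with \<open>i\<close> and \<open>j\<close> exchanged gives
  \<open>Z\<^sub>i\<^sub>j (1 - t\<^sub>i t\<^sub>j) = 0\<close>.
\<close>
lemma only_zero_cosquare_upper_triangular:
  fixes T :: "'a::field mat"
  assumes T: "T \<in> carrier_mat n n" and ut: "upper_triangular T"
    and diag: "\<And>i. i < n \<Longrightarrow> T $$ (i,i) \<noteq> 1"
    and pairs: "\<And>i j. i < n \<Longrightarrow> j < n \<Longrightarrow> i \<noteq> j \<Longrightarrow> T $$ (i,i) * T $$ (j,j) \<noteq> 1"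
  shows "only_zero_cosquare n T"
  unfolding only_zero_cosquare_def
proof (intro ballI impI)
  fix Z assume Z: "Z \<in> carrier_mat n n" and eq: "Z = transpose_mat Z * T"
  have "Z $$ (i,j) = 0" if "i < n" "j < n" for i j
    using that
  proof (induction "i + j" arbitrary: i j rule: less_induct)
    case less
    have swap: "Z $$ (a,b) = Z $$ (b,a) * T $$ (b,b)" if "a < n" "b < n" "a + b = i + j" for a b
    proof -
      have "Z $$ (a,b) = (\<Sum>k<n. Z $$ (k,a) * T $$ (k,b))"
        by (rule eq_transpose_multD[OF Z T eq that(1,2)])
      also have "\<dots> = Z $$ (b,a) * T $$ (b,b) + (\<Sum>k\<in>{..<n}-{b}. Z $$ (k,a) * T $$ (k,b))"
        using that by (intro sum.remove) auto
      also have "(\<Sum>k\<in>{..<n}-{b}. Z $$ (k,a) * T $$ (k,b)) = 0"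
      proof (rule sum.neutral, intro ballI)
        fix k assume k: "k \<in> {..<n} - {b}"
        show "Z $$ (k,a) * T $$ (k,b) = 0"
        proof (cases "k < b")
          case True
          then show ?thesis using less(1)[of k a] that k by simp
        next
          case False
          then show ?thesis using ut k T unfolding upper_triangular_def by simp
        qed
      qed
      finally show ?thesis by simp
    qed
    have ij: "Z $$ (i,j) = Z $$ (j,i) * T $$ (j,j)" using less.prems by (intro swap) auto
    show ?case
    proof (cases "i = j")
      case True
      have "Z $$ (i,i) * (1 - T $$ (i,i)) = 0" using ij True by (simp add: algebra_simps)
      then show ?thesis using diag[OF less.prems(1)] True by auto
    next
      case False
      have ji: "Z $$ (j,i) = Z $$ (i,j) * T $$ (i,i)" using less.prems by (intro swap) auto
      have "Z $$ (i,j) * (1 - T $$ (i,i) * T $$ (j,j)) = 0"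
        using ij unfolding ji by (simp add: algebra_simps)
      then show ?thesis using pairs[OF less.prems False] by auto
    qed
  qed
  then show "Z = 0\<^sub>m n n" using Z by (intro eq_matI) auto
qed

text \<open>
  Both corner lemmas concern \<open>T\<^sup>T\<close>, which is lower triangular: there a solution \<open>Z\<close> can be
  supported in a leading block, because column \<open>j\<close> of \<open>Z\<^sup>T T\<^sup>T\<close> only involves the entries \<open>T\<^sub>j\<^sub>k\<close>
  with \<open>k \<ge> j\<close>.  In terms of eigenvectors: if \<open>u\<^sup>T M = u\<^sup>T\<close>, then \<open>u u\<^sup>T\<close> is a solution.
\<close>
lemma not_only_zero_cosquare_corner_one:
  fixes T :: "'a::field mat"
  assumes T: "T \<in> carrier_mat n n" and ut: "upper_triangular T"
    and n: "0 < n" and one: "T $$ (0,0) = 1"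
  shows "\<not> only_zero_cosquare n (transpose_mat T)"
proof
  assume triv: "only_zero_cosquare n (transpose_mat T)"
  define Z :: "'a mat" where "Z = mat n n (\<lambda>(i,j). if i = 0 \<and> j = 0 then 1 else 0)"
  have Z: "Z \<in> carrier_mat n n" by (simp add: Z_def)
  have low: "T $$ (j,0) = (if j = 0 then 1 else 0)" if "j < n" for j
    using that ut one T unfolding upper_triangular_def by simp
  have "Z = transpose_mat Z * transpose_mat T"
  proof (rule eq_transpose_multI[OF Z])
    fix i j assume ij: "i < n" "j < n"
    obtain m where m: "n = Suc m" using n gr0_implies_Suc by blast
    have "(\<Sum>k<n. Z $$ (k,i) * transpose_mat T $$ (k,j)) = Z $$ (0,i) * T $$ (j,0)"
      unfolding m sum.lessThan_Suc_shift using ij T m by (simp add: Z_def)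
    also have "\<dots> = Z $$ (i,j)" using ij low[OF ij(2)] n by (simp add: Z_def)
    finally show "Z $$ (i,j) = (\<Sum>k<n. Z $$ (k,i) * transpose_mat T $$ (k,j))" by simp
  qed (use T in simp)
  then have "Z = 0\<^sub>m n n" using triv Z unfolding only_zero_cosquare_def by blast
  then have "Z $$ (0,0) = 0" using n by simp
  then show False using n by (simp add: Z_def)
qed

lemma sum_first_two:
  fixes f :: "nat \<Rightarrow> 'a::comm_monoid_add"
  assumes "1 < n" and "\<And>k. 1 < k \<Longrightarrow> k < n \<Longrightarrow> f k = 0"
  shows "(\<Sum>k<n. f k) = f 0 + f 1"
proof -
  have "(\<Sum>k<n. f k) = (\<Sum>k\<in>{0,1}. f k)"
    using assms by (intro sum.mono_neutral_right) auto
  then show ?thesis by simp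
qed

text \<open>
  The invariant form of the solution: let \<open>u\<^sup>T M = a u\<^sup>T\<close> and \<open>v\<^sup>T M = b v\<^sup>T + d u\<^sup>T\<close> with
  \<open>a b = 1\<close>.  Then \<open>c u u\<^sup>T + b u v\<^sup>T + v u\<^sup>T\<close> is a solution as soon as \<open>c (1 - a) = d\<close>.
  The term with \<open>c\<close> absorbs the coupling \<open>d\<close>, so distinct eigenvalues and a
  Jordan block for \<open>-1\<close> are covered by one formula; this is where \<open>a \<noteq> 1\<close> enters.
\<close>
lemma not_only_zero_cosquare_corner_pair:
  fixes T :: "'a::field mat"
  assumes T: "T \<in> carrier_mat n n" and ut: "upper_triangular T"
    and n: "1 < n" and prod: "T $$ (0,0) * T $$ (1,1) = 1" and ne: "T $$ (0,0) \<noteq> 1"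
  shows "\<not> only_zero_cosquare n (transpose_mat T)"
proof
  assume triv: "only_zero_cosquare n (transpose_mat T)"
  define c where "c = T $$ (0,1) / (1 - T $$ (0,0))"
  have c: "c * T $$ (0,0) + T $$ (0,1) = c"
  proof -
    have "c * (1 - T $$ (0,0)) = T $$ (0,1)" using ne by (simp add: c_def)
    then show ?thesis by (simp add: algebra_simps)
  qed
  define z where "z i j = (if i = 0 \<and> j = 0 then c
      else if i = 0 \<and> j = 1 then T $$ (1,1)
      else if i = 1 \<and> j = 0 then 1 else 0)" for i j :: nat
  define Z where "Z = mat n n (\<lambda>(i,j). z i j)"
  have Z: "Z \<in> carrier_mat n n" by (simp add: Z_def)
  have Zz: "Z $$ (i,j) = z i j" if "i < n" "j < n" for i j using that by (simp add: Z_def)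
  have low: "T $$ (j,k) = 0" if "k < j" "j < n" for j k
    using that ut T unfolding upper_triangular_def by simp
  have "Z = transpose_mat Z * transpose_mat T"
  proof (rule eq_transpose_multI[OF Z])
    fix i j assume ij: "i < n" "j < n"
    have "(\<Sum>k<n. Z $$ (k,i) * transpose_mat T $$ (k,j)) = (\<Sum>k<n. z k i * T $$ (j,k))"
      using ij T by (intro sum.cong[OF refl]) (simp add: Zz)
    also have "\<dots> = z 0 i * T $$ (j,0) + z 1 i * T $$ (j,1)"
      by (rule sum_first_two[OF n]) (simp add: z_def)
    also have "\<dots> = z i j"
    proof -
      consider "j = 0" | "j = 1" | "1 < j" by linarith
      then show ?thesis
      proof cases
        case 1
        then show ?thesis using c prod by (simp add: z_def mult.commute)
      next
        case 2
        then show ?thesis using low[of 0 1] n by (simp add: z_def)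
      next
        case 3
        then show ?thesis using ij low[of 0 j] low[of 1 j] by (simp add: z_def)
      qed
    qed
    finally show "Z $$ (i,j) = (\<Sum>k<n. Z $$ (k,i) * transpose_mat T $$ (k,j))"
      using Zz[OF ij] by simp
  qed (use T in simp)
  then have "Z = 0\<^sub>m n n" using triv Z unfolding only_zero_cosquare_def by blast
  then have "Z $$ (1,0) = 0" using n by simp
  then show False using n by (simp add: Zz z_def)
qed

section \<open>Eigenvalues that force a nonzero solution\<close>

lemma char_poly_extend_linear_factors:
  fixes M :: "complex mat"
  assumes M: "M \<in> carrier_mat n n" and dvd: "(\<Prod>e\<leftarrow>ds. [:- e, 1:]) dvd char_poly M"
  obtains es where "char_poly M = (\<Prod>e\<leftarrow>ds @ es. [:- e, 1:])"
proof -
  let ?d = "\<Prod>e\<leftarrow>ds. [:- e, 1:]"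
  from dvd obtain r where r: "char_poly M = ?d * r" by (elim dvdE)
  have "lead_coeff (char_poly M) = 1" using degree_monic_char_poly[OF M] by simp
  moreover have "lead_coeff ?d = 1" by (induction ds) (auto simp: lead_coeff_mult simp del: mult_pCons_left)
  ultimately have "lead_coeff r = 1" unfolding r lead_coeff_mult by simp
  moreover obtain es where "Polynomial.smult (lead_coeff r) (\<Prod>e\<leftarrow>es. [:- e, 1:]) = r"
    using fundamental_theorem_algebra_factorized by blast
  ultimately have "r = (\<Prod>e\<leftarrow>es. [:- e, 1:])" by simp
  then show thesis using that[of es] r by simp
qed

text \<open>
  The Schur decomposition lets the order of the eigenvalues be prescribed, so any linear factors of
  the characteristic polynomial can be moved to the front.  It is applied to \<open>M\<^sup>T\<close> since the
  corner solutions need \<open>M\<close> to be similar to a lower triangular matrix.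
\<close>
lemma similar_transpose_upper_triangular:
  fixes M :: "complex mat"
  assumes M: "M \<in> carrier_mat n n" and dvd: "(\<Prod>e\<leftarrow>ds. [:- e, 1:]) dvd char_poly M"
  obtains T es where "T \<in> carrier_mat n n" "upper_triangular T" "diag_mat T = ds @ es"
    "similar_mat M (transpose_mat T)"
proof -
  have Mt: "transpose_mat M \<in> carrier_mat n n" using M by simp
  obtain es where "char_poly M = (\<Prod>e\<leftarrow>ds @ es. [:- e, 1:])"
    using char_poly_extend_linear_factors[OF M dvd] .
  then have cp: "char_poly (transpose_mat M) = (\<Prod>e\<leftarrow>ds @ es. [:- e, 1:])"
    using M by simp
  obtain T P Q where "schur_decomposition (transpose_mat M) (ds @ es) = (T,P,Q)"
    by (cases "schur_decomposition (transpose_mat M) (ds @ es)")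
  from schur_decomposition[OF Mt cp this]
  have wit: "similar_mat_wit (transpose_mat M) T P Q" and ut: "upper_triangular T"
    and diag: "diag_mat T = ds @ es" by auto
  note w = similar_mat_witD2[OF Mt wit]
  have "transpose_mat Q * transpose_mat P = 1\<^sub>m n"
    unfolding transpose_mult[OF w(6,7), symmetric] w(1) by simp
  moreover have "transpose_mat P * transpose_mat Q = 1\<^sub>m n"
    unfolding transpose_mult[OF w(7,6), symmetric] w(2) by simp
  moreover have "M = transpose_mat Q * transpose_mat T * transpose_mat P"
    using arg_cong[OF w(3), of transpose_mat] w(5-7)
    by (simp add: transpose_mult[of _ n n _ n] assoc_mult_mat[of _ n n _ n _ n])
  ultimately have "similar_mat M (transpose_mat T)"
    using M w(5-7) by (intro similar_matI[of M "transpose_mat T" "transpose_mat Q" "transpose_mat P" n]) simp_all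
  then show thesis using that w(5) ut diag by blast
qed

lemma diag_mat_nth: "T \<in> carrier_mat n n \<Longrightarrow> i < n \<Longrightarrow> diag_mat T ! i = T $$ (i,i)"
  by (simp add: diag_mat_def)

lemma not_only_zero_cosquare_eigenvalue_one:
  fixes M :: "complex mat"
  assumes M: "M \<in> carrier_mat n n" and root: "poly (char_poly M) 1 = 0"
  shows "\<not> only_zero_cosquare n M"
proof -
  have "(\<Prod>e\<leftarrow>[1]. [:- e, 1:]) dvd char_poly M" using root by (simp add: poly_eq_0_iff_dvd)
  from similar_transpose_upper_triangular[OF M this] obtain T es where
    T: "T \<in> carrier_mat n n" "upper_triangular T" "diag_mat T = [1] @ es" "similar_mat M (transpose_mat T)" .
  have n: "0 < n" using arg_cong[OF T(3), of length] T(1) by (simp add: diag_mat_def)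
  have "T $$ (0,0) = 1" using diag_mat_nth[OF T(1) n] T(3) by simp
  then have "\<not> only_zero_cosquare n (transpose_mat T)"
    by (rule not_only_zero_cosquare_corner_one[OF T(1,2) n])
  then show ?thesis using only_zero_cosquare_similar[OF M T(4)] by blast
qed

text \<open>
  The eigenvalues are given as a divisor of the characteristic polynomial so that \<open>a = b = -1\<close>
  expresses algebraic multiplicity at least two, whatever the geometric multiplicity is.
\<close>
lemma not_only_zero_cosquare_eigenvalue_pair:
  fixes M :: "complex mat"
  assumes M: "M \<in> carrier_mat n n" and dvd: "[:- a, 1:] * [:- b, 1:] dvd char_poly M"
    and ab: "a * b = 1" and ne: "a \<noteq> 1"
  shows "\<not> only_zero_cosquare n M"
proof -
  have "(\<Prod>e\<leftarrow>[a,b]. [:- e, 1:]) dvd char_poly M" using dvd by simp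
  from similar_transpose_upper_triangular[OF M this] obtain T es where
    T: "T \<in> carrier_mat n n" "upper_triangular T" "diag_mat T = [a,b] @ es" "similar_mat M (transpose_mat T)" .
  have n: "1 < n" using arg_cong[OF T(3), of length] T(1) by (simp add: diag_mat_def)
  have "T $$ (0,0) = a" "T $$ (1,1) = b"
    using diag_mat_nth[OF T(1), of 0] diag_mat_nth[OF T(1), of 1] n T(3) by simp_all
  then have "\<not> only_zero_cosquare n (transpose_mat T)"
    using ab ne by (intro not_only_zero_cosquare_corner_pair[OF T(1,2) n]) simp_all
  then show ?thesis using only_zero_cosquare_similar[OF M T(4)] by blast
qed

section \<open>The spectral criterion\<close>

lemma char_poly_nonzero: "M \<in> carrier_mat n n \<Longrightarrow> char_poly (M :: 'a::field mat) \<noteq> 0"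
  using degree_monic_char_poly by (metis coeff_0 zero_neq_one)

lemma spectrum_iff_root:
  "M \<in> carrier_mat n n \<Longrightarrow> x \<in> spectrum (M :: 'a::field mat) \<longleftrightarrow> poly (char_poly M) x = 0"
  unfolding spectrum_def by (simp add: eigenvalue_root_char_poly)

text \<open>
  Only \<open>x\<close> has to be kept away from \<open>-1\<close>: if \<open>x y = 1\<close>, then \<open>y \<noteq> -1\<close> as well.
  Two eigenvalues with product 1 are distinct here, since a number equal to its reciprocal is
  \<open>\<plusminus>1\<close> and 1 is excluded separately; hence both linear factors divide the characteristic polynomial
  together.
\<close>
lemma eigenvalue_product_ne_one_if_only_zero_cosquare:
  fixes M :: "complex mat"
  assumes M: "M \<in> carrier_mat n n" and triv: "only_zero_cosquare n M"
    and x: "x \<in> spectrum M" "x \<noteq> -1" and y: "y \<in> spectrum M"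
  shows "x * y \<noteq> 1"
proof
  assume prod: "x * y = 1"
  have rx: "poly (char_poly M) x = 0" and ry: "poly (char_poly M) y = 0"
    using x y spectrum_iff_root[OF M] by blast+
  have x1: "x \<noteq> 1" using not_only_zero_cosquare_eigenvalue_one[OF M] triv rx by blast
  have "x \<noteq> y"
  proof
    assume "x = y"
    with prod have "x = 1 \<or> x = -1" by (simp add: square_eq_1_iff)
    then show False using x1 x by blast
  qed
  obtain q where q: "char_poly M = [:- x, 1:] * q" using rx unfolding poly_eq_0_iff_dvd by (rule dvdE)
  have "poly q y = 0" using ry \<open>x \<noteq> y\<close> unfolding q poly_mult by simp
  then have "[:- x, 1:] * [:- y, 1:] dvd char_poly M"
    unfolding q poly_eq_0_iff_dvd by (rule mult_dvd_mono[OF dvd_refl])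
  then show False using not_only_zero_cosquare_eigenvalue_pair[OF M _ prod x1] triv by blast
qed

lemma order_minus_one_if_only_zero_cosquare:
  fixes M :: "complex mat"
  assumes M: "M \<in> carrier_mat n n" and triv: "only_zero_cosquare n M"
  shows "order (-1) (char_poly M) \<le> 1"
proof (rule ccontr)
  assume "\<not> order (-1) (char_poly M) \<le> 1"
  then have "2 \<le> order (-1) (char_poly M)" by linarith
  then have "[:- (-1), 1:] ^ 2 dvd char_poly M" using order_divides by blast
  then have "[:- (-1), 1:] * [:- (-1), 1:] dvd char_poly M" unfolding power2_eq_square .
  then show False
    using not_only_zero_cosquare_eigenvalue_pair[OF M, of "-1" "-1"] triv by simp
qed

lemma char_poly_eq_prod_diag:
  fixes T :: "'a::field mat"
  assumes T: "T \<in> carrier_mat n n" and ut: "upper_triangular T"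
  shows "char_poly T = (\<Prod>i<n. [:- T $$ (i,i), 1:])"
proof -
  let ?ps = "map (\<lambda>e. [:- e, 1:]) (diag_mat T)"
  have len: "length ?ps = n" using T by (simp add: diag_mat_def)
  have "char_poly T = prod_list ?ps" by (rule char_poly_upper_triangular[OF T ut])
  also have "\<dots> = (\<Prod>i = 0..<n. ?ps ! i)" unfolding prod.list_conv_set_nth len ..
  also have "\<dots> = (\<Prod>i<n. [:- T $$ (i,i), 1:])"
    unfolding lessThan_atLeast0 by (rule prod.cong[OF refl]) (use T in \<open>simp add: diag_mat_def\<close>)
  finally show ?thesis .
qed

text \<open>
  In a Schur form, diagonal entries at distinct positions with product 1 cannot both differ from
  \<open>-1\<close>; hence both equal \<open>-1\<close>, which makes \<open>-1\<close> a root of multiplicity at least two.  A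
  diagonal entry 1 violates reciprocal freeness by itself.
\<close>
lemma only_zero_cosquare_if_reciprocal_free:
  fixes M :: "complex mat"
  assumes M: "M \<in> carrier_mat n n"
    and free: "top_reciprocal_free (spectrum M - {-1})"
    and simple: "order (-1) (char_poly M) \<le> 1"
  shows "only_zero_cosquare n M"
proof -
  obtain es where "char_poly M = (\<Prod>e\<leftarrow>es. [:- e, 1:])" using char_poly_factorized[OF M] by blast
  from schur_decomposition_exists[OF M this] obtain T where T: "T \<in> carrier_mat n n"
    and ut: "upper_triangular T" and sim: "similar_mat M T" by blast
  have cp: "char_poly M = (\<Prod>i<n. [:- T $$ (i,i), 1:])"
    unfolding char_poly_similar[OF sim] by (rule char_poly_eq_prod_diag[OF T ut])
  have ev: "T $$ (i,i) \<in> spectrum M" if "i < n" for i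
    unfolding spectrum_iff_root[OF M] cp poly_prod
    using that by (intro prod_zero bexI[of _ i]) simp_all
  have free': "a * b \<noteq> 1" if "a \<in> spectrum M" "b \<in> spectrum M" "a \<noteq> -1" "b \<noteq> -1" for a b
    using free that unfolding top_reciprocal_free_def by blast
  have "only_zero_cosquare n T"
  proof (rule only_zero_cosquare_upper_triangular[OF T ut])
    show "T $$ (i,i) \<noteq> 1" if "i < n" for i
      using free'[OF ev[OF that] ev[OF that]] by force
    show "T $$ (i,i) * T $$ (j,j) \<noteq> 1" if ij: "i < n" "j < n" "i \<noteq> j" for i j
    proof
      assume prod: "T $$ (i,i) * T $$ (j,j) = 1"
      have "T $$ (i,i) = -1 \<or> T $$ (j,j) = -1" using free' ev ij prod by blast
      then have m1: "T $$ (i,i) = -1" "T $$ (j,j) = -1"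
        using prod by (metis mult_minus1 mult_minus1_right minus_minus)+
      let ?f = "\<lambda>k. [:- T $$ (k,k), 1:]"
      have "char_poly M = ?f i * prod ?f ({..<n} - {i})"
        unfolding cp by (rule prod.remove) (use ij in simp_all)
      also have "prod ?f ({..<n} - {i}) = ?f j * prod ?f ({..<n} - {i} - {j})"
        by (rule prod.remove) (use ij in simp_all)
      finally have "char_poly M = [:- (-1), 1:] * [:- (-1), 1:] * prod ?f ({..<n} - {i} - {j})"
        by (simp only: m1 mult.assoc)
      then have "[:- (-1), 1:] * [:- (-1), 1:] dvd char_poly M" by (rule dvdI)
      then have "[:- (-1), 1:] ^ 2 dvd char_poly M" unfolding power2_eq_square .
      then have "2 \<le> order (-1) (char_poly M)"
        using char_poly_nonzero[OF M] order_divides by blast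
      then show False using simple by linarith
    qed
  qed
  then show ?thesis
    by (rule only_zero_cosquare_similar[OF T similar_mat_sym[OF sim]])
qed

text \<open>
  The order of \<open>-1\<close> as a root is positive exactly if \<open>-1\<close> is an eigenvalue; therefore order at
  most one says the same as the conditional simplicity of \<open>-1\<close>.
\<close>
theorem theorem2p1:
  fixes A B :: "real mat" and n :: nat
  assumes "A \<in> carrier_mat n n" and "B \<in> carrier_mat n n"
  shows "top_stein_uniquely_solvable n A B \<longleftrightarrow>
    top_reciprocal_free (complex_spectrum (transpose_mat A * B) - {-1}) \<and>
    (-1 \<in> complex_spectrum (transpose_mat A * B) \<longrightarrow>
       simple_eigenvalue (transpose_mat A * B) (-1))"
proof -
  define M where "M = map_mat complex_of_real (transpose_mat A * B)"
  have M: "M \<in> carrier_mat n n" using assms by (simp add: M_def)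
  have order_pos: "-1 \<in> spectrum M \<longleftrightarrow> order (-1) (char_poly M) \<noteq> 0"
    using spectrum_iff_root[OF M] order_root char_poly_nonzero[OF M] by metis
  have "top_stein_uniquely_solvable n A B \<longleftrightarrow> only_zero_cosquare n M"
    unfolding M_def uniquely_solvable_iff_only_zero_cosquare[OF assms]
    by (rule only_zero_cosquare_of_real) (use assms in simp)
  also have "\<dots> \<longleftrightarrow> top_reciprocal_free (spectrum M - {-1}) \<and> order (-1) (char_poly M) \<le> 1"
    using only_zero_cosquare_if_reciprocal_free[OF M] order_minus_one_if_only_zero_cosquare[OF M]
      eigenvalue_product_ne_one_if_only_zero_cosquare[OF M]
    unfolding top_reciprocal_free_def by blast
  also have "order (-1) (char_poly M) \<le> 1 \<longleftrightarrow>
      (-1 \<in> spectrum M \<longrightarrow> order (-1) (char_poly M) = 1)"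
    using order_pos by linarith
  finally show ?thesis
    using order_pos
    unfolding simple_eigenvalue_def algebraic_multiplicity_def complex_spectrum_def M_def by blast
qed

end
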